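(* Let $m$ be an odd positive integer, $q=2^m$, and $\gamma\in\mathbb{F}_q$. Let $f(X)=X+\gamma\,\mathrm{Tr}_{q}^{q^2}\left(X+X^3+X^{q+2}+X^{2q-1}\right)$. Then $f(X)$ is a permutation polynomial over $\mathbb{F}_{q^2}$ if and only if $\gamma\in\{0,1\}$.
   Context: For a prime power $q$, $\mathbb{F}_q$ is the finite field with $q$ elements. $\mathrm{Tr}_{q}^{q^2}(x)=x+x^q$ is the relative trace from $\mathbb{F}_{q^2}$ to $\mathbb{F}_q$. A polynomial $f\in\mathbb{F}_{Q}[X]$ is a permutation polynomial over $\mathbb{F}_{Q}$ if the map $c\mapsto f(c)$ is a bijection of $\mathbb{F}_{Q}$ to itself. *)

theory Defs
  imports "HOL-Computational_Algebra.Polynomial" "HOL-Computational_Algebra.Primes"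
    "HOL-Library.Cardinality"
begin

definition is_subfield :: "'a::field set \<Rightarrow> bool" where
  "is_subfield K \<longleftrightarrow> 0 \<in> K \<and> 1 \<in> K \<and>
     (\<forall>x\<in>K. \<forall>y\<in>K. x + y \<in> K \<and> x * y \<in> K) \<and>
     (\<forall>x\<in>K. - x \<in> K \<and> inverse x \<in> K)"

(* The relative trace from the field with q^2 elements to the field with q elements.
   It is polymorphic so that it can be applied to a polynomial g (giving the formal
   expression g + g^q) as well as to a field element; evaluation relates the two. *)
definition rel_trace :: "nat \<Rightarrow> 'a::comm_semiring_1 \<Rightarrow> 'a" where
  "rel_trace q x = x + x ^ q"

lemma poly_rel_trace: "poly (rel_trace q g) c = rel_trace q (poly g c)"
  by (simp add: rel_trace_def)

definition permutation_polynomial :: "'a::finite_field poly \<Rightarrow> bool" where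
  "permutation_polynomial f \<longleftrightarrow> bij (\<lambda>c. poly f c)"

abbreviation X :: "'a::comm_semiring_1 poly" where
  "X \<equiv> [:0, 1:]"

end

theory Submission
  imports Defs
begin

text \<open>
  Put $t = x + x^q$ and $n = x^{q+1}$. In characteristic 2 the trace in $f$ collapses to
  $t^3 (1 + 1/n)$ for $x \neq 0$. Two points with the same image differ by an element of the small
  field and hence have the same $t$; after scaling to $t = 1$, a collision amounts to $u, v, w$ in
  the small field with $uvw = \gamma$, $u + v + w = 1$, $u \neq 1$ and $uv$ of absolute trace 1,
  where $n = uv$.

  For $\gamma = 1$ this is impossible, since $uv = l^2 + l$ with $l = (u+1)/(u+v)$ has trace 0.
  For $\gamma \notin \{0, 1\}$, solving for $u, v$ with $w$ given leaves two conditions on $w$, namely that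
  $\gamma/w$ and $(\gamma + \sqrt\gamma)/(w+1)$ have trace 1. For $q \geq 8$ they can be met
  simultaneously, because otherwise a nonzero polynomial of degree less than $q/2$ would have
  $q/2$ zeros. For $q = 2$ no such $\gamma$ exists.
\<close>

subsection \<open>Traces in finite fields of characteristic 2\<close>

text \<open>Translation by 1 permutes the ring, so adding 1 to every summand leaves the total
  unchanged.\<close>

lemma of_nat_CARD_eq_0: "of_nat CARD('a) = (0 :: 'a::{finite,ring_1})"
proof -
  have "(\<Sum>x\<in>UNIV. x + 1) = (\<Sum>x\<in>UNIV. x :: 'a)"
    by (rule sum.reindex_bij_witness[of _ "\<lambda>x. x - 1" "\<lambda>x. x + 1"]) auto
  then show ?thesis
    by (simp add: sum.distrib)
qed

lemma CHAR_eq_2_if_CARD: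
  assumes "CARD('a::finite_field) = 2 ^ n"
  shows "CHAR('a) = 2"
proof -
  have "CHAR('a) dvd 2 ^ n"
    using of_nat_CARD_eq_0[where ?'a = 'a] assms by (simp only: of_nat_eq_0_iff_char_dvd)
  then have "CHAR('a) dvd 2"
    using CHAR_prime[where ?'a = 'a] prime_dvd_power by blast
  then show ?thesis
    using CHAR_prime[where ?'a = 'a] primes_dvd_imp_eq two_is_prime_nat by blast
qed

lemma is_subfield_UNIV: "is_subfield UNIV"
  by (simp add: is_subfield_def)

text \<open>Multiplication by a nonzero \<open>x\<close> permutes \<open>K - {0}\<close>; comparing
  the products over this set gives the exponent.\<close>

lemma subfield_power_card:
  fixes x :: "'a::field"
  assumes "is_subfield K" "finite K" "x \<in> K"
  shows "x ^ card K = x"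
proof (cases "x = 0")
  case True
  then show ?thesis
    using assms by (auto simp: card_gt_0_iff zero_power)
next
  case False
  have "(\<Prod>y\<in>K-{0}. x * y) = (\<Prod>y\<in>K-{0}. y)"
    by (rule prod.reindex_bij_witness[of _ "\<lambda>y. inverse x * y" "\<lambda>y. x * y"])
       (use assms False in \<open>auto simp: is_subfield_def\<close>)
  then have "x ^ card (K - {0}) = 1"
    using assms(2) by (simp add: prod.distrib)
  moreover have "card K = Suc (card (K - {0}))"
    using assms card.remove[of K 0] by (simp add: is_subfield_def)
  ultimately show ?thesis
    by simp
qed

text \<open>\<open>K\<close> is kept apart from the ambient type so that the results also apply with
  \<open>K = UNIV\<close>, which \<open>artin_schreier_root\<close> exploits.\<close>

locale char2_subfield =
  fixes K :: "'a::finite_field set" and k :: nat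
  assumes char2: "CHAR('a) = 2"
    and subfield: "is_subfield K"
    and card_K: "card K = 2 ^ k"
begin

lemma zero_mem [simp, intro]: "0 \<in> K"
  and one_mem [simp, intro]: "1 \<in> K"
  and add_mem [simp, intro]: "x \<in> K \<Longrightarrow> y \<in> K \<Longrightarrow> x + y \<in> K"
  and mult_mem [simp, intro]: "x \<in> K \<Longrightarrow> y \<in> K \<Longrightarrow> x * y \<in> K"
  and inverse_mem [simp, intro]: "x \<in> K \<Longrightarrow> inverse x \<in> K"
  using subfield by (auto simp: is_subfield_def)

lemma divide_mem [simp, intro]: "x \<in> K \<Longrightarrow> y \<in> K \<Longrightarrow> x / y \<in> K"
  by (simp add: divide_inverse)

lemma power_mem [simp, intro]: "x \<in> K \<Longrightarrow> x ^ n \<in> K"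
  by (induction n) auto

lemma add_self: "x + x = (0 :: 'a)"
  using minus_CHAR_2[OF char2, of x x] by simp

lemma add_add_self: "x + (x + y) = (y :: 'a)"
  by (simp add: add_self flip: add.assoc)

lemma minus_eq: "- x = (x :: 'a)" "x - y = (x + y :: 'a)"
  using uminus_CHAR_2[OF char2] minus_CHAR_2[OF char2] by auto

lemmas char2_simps = add_self add_add_self minus_eq

lemma add_eq_0_iff_eq: "x + y = 0 \<longleftrightarrow> x = (y :: 'a)"
  by (metis minus_eq(2) right_minus_eq)

lemma frobenius_add: "(x + y :: 'a) ^ (2 ^ n) = x ^ (2 ^ n) + y ^ (2 ^ n)"
  by (rule freshmans_dream') (simp_all add: char2)

lemma square_add: "(x + y :: 'a)\<^sup>2 = x\<^sup>2 + y\<^sup>2"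
  using frobenius_add[of x y 1] by simp

lemma k_pos: "k > 0"
proof (rule ccontr)
  assume "\<not> k > 0"
  then have "card K = 1"
    using card_K by simp
  then show False
    using zero_mem one_mem by (metis card_1_singletonE singletonD zero_neq_one)
qed

lemma card_K_eq_double: "card K = 2 * 2 ^ (k - 1)"
  using card_K k_pos by (simp flip: power_Suc)

lemma power_card_eq: "x \<in> K \<Longrightarrow> x ^ (2 ^ k) = x"
  using subfield_power_card[OF subfield] card_K by auto

text \<open>The polynomial X^(2^k) - X has at most \<open>card K\<close> roots, and all of
  \<open>K\<close> are roots. This is how traces and norms are recognised as elements of
  \<open>K\<close>.\<close>

lemma mem_iff: "x \<in> K \<longleftrightarrow> x ^ (2 ^ k) = x"
proof -
  define P :: "'a poly" where "P = monom 1 (2 ^ k) - monom 1 1"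
  have poly_P: "poly P x = x ^ (2 ^ k) - x" for x
    by (simp add: P_def poly_monom)
  have k: "(2::nat) ^ k \<noteq> 1"
    using k_pos by simp
  then have "coeff P 1 = - 1"
    by (simp add: P_def)
  then have "P \<noteq> 0"
    by auto
  have "K \<subseteq> {x. poly P x = 0}"
    using power_card_eq by (auto simp: poly_P)
  moreover have "card {x. poly P x = 0} \<le> card K"
  proof -
    have "degree P \<le> 2 ^ k"
      unfolding P_def by (intro degree_diff_le order.trans[OF degree_monom_le]) auto
    then show ?thesis
      using card_poly_roots_bound[OF \<open>P \<noteq> 0\<close>] card_K by linarith
  qed
  ultimately have "K = {x. poly P x = 0}"
    by (intro card_seteq) auto
  then show ?thesis
    by (auto simp: poly_P)
qed

section \<open>The absolute trace of the small field\<close>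

definition T :: "'a \<Rightarrow> 'a" where
  "T x = (\<Sum>i<k. x ^ (2 ^ i))"

lemma T_0 [simp]: "T 0 = 0"
  by (simp add: T_def zero_power)

lemma T_add: "T (x + y) = T x + T y"
  by (simp add: T_def frobenius_add sum.distrib)

lemma T_square_eq: "(T x)\<^sup>2 = T (x\<^sup>2)"
proof -
  have "(T x)\<^sup>2 = (\<Sum>i<k. (x ^ (2 ^ i))\<^sup>2)"
    unfolding T_def by (rule freshmans_dream_sum) (simp_all add: char2)
  then show ?thesis
    by (simp add: T_def mult.commute flip: power_mult)
qed

text \<open>The sum telescopes. It holds on the whole ambient field, and is later applied to an
  element outside \<open>K\<close>.\<close>

lemma T_square_add: "T (x\<^sup>2) + T x = x ^ (2 ^ k) + x"
proof -
  have "T (x\<^sup>2) = (\<Sum>i<k. x ^ (2 ^ Suc i))"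
    by (simp add: T_def flip: power_mult)
  then have "T (x\<^sup>2) + T x = (\<Sum>i<k. x ^ (2 ^ Suc i) - x ^ (2 ^ i))"
    by (simp add: T_def sum.distrib minus_eq)
  also have "\<dots> = x ^ (2 ^ k) - x ^ (2 ^ 0)"
    by (rule sum_lessThan_telescope)
  finally show ?thesis
    by (simp add: minus_eq)
qed

lemma T_square:
  assumes "x \<in> K"
  shows "T (x\<^sup>2) = T x"
  using T_square_add[of x] power_card_eq[OF assms] by (simp add: add_eq_0_iff_eq add_self)

lemma T_cases:
  assumes "x \<in> K"
  shows "T x = 0 \<or> T x = 1"
proof -
  have "T x * T x = T x"
    using T_square_eq[of x] T_square[OF assms] by (simp add: power2_eq_square)
  then show ?thesis
    by auto
qed

definition trace_poly :: "'a \<Rightarrow> 'a poly" where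
  "trace_poly c = (\<Sum>i<k. monom (c ^ (2 ^ i)) (2 ^ i))"

lemma poly_trace_poly: "poly (trace_poly c) x = T (c * x)"
  by (simp add: trace_poly_def T_def poly_sum poly_monom power_mult_distrib)

lemma coeff_trace_poly: "coeff (trace_poly c) n = (\<Sum>i<k. if 2 ^ i = n then c ^ n else 0)"
  unfolding trace_poly_def coeff_sum by (rule sum.cong) auto

lemma coeff_trace_poly_power:
  assumes "i < k"
  shows "coeff (trace_poly c) (2 ^ i) = c ^ (2 ^ i)"
  using assms by (simp add: coeff_trace_poly)

lemma degree_trace_poly: "degree (trace_poly c) \<le> 2 ^ (k - 1)"
  unfolding trace_poly_def
  by (intro degree_sum_le order.trans[OF degree_monom_le]) auto

text \<open>Each of the two fibres consists of roots of a polynomial of degree at most |K|/2, and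
  together they exhaust \<open>K\<close>, so both bounds are attained.\<close>

lemma card_T_fibre:
  assumes "c \<in> K" "c \<noteq> 0" "e \<in> {0, 1}"
  shows "card {x \<in> K. T (c * x) = e} = 2 ^ (k - 1)"
proof -
  have le: "card {x \<in> K. T (c * x) = e} \<le> 2 ^ (k - 1)" for e
  proof -
    define P where "P = trace_poly c - [:e:]"
    \<comment> \<open>The exponent is positive, so subtracting the constant \<open>e\<close> does
      not affect this coefficient.\<close>
    have "coeff P (2 ^ (k - 1)) = c ^ (2 ^ (k - 1))"
      unfolding P_def using k_pos by (simp add: coeff_trace_poly_power coeff_pCons split: nat.split)
    then have "P \<noteq> 0"
      using \<open>c \<noteq> 0\<close> by auto
    have "degree P \<le> 2 ^ (k - 1)"
      unfolding P_def by (intro degree_diff_le degree_trace_poly) auto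
    moreover have "{x \<in> K. T (c * x) = e} \<subseteq> {x. poly P x = 0}"
      by (auto simp: P_def poly_trace_poly)
    then have "card {x \<in> K. T (c * x) = e} \<le> card {x. poly P x = 0}"
      by (intro card_mono) auto
    ultimately show ?thesis
      using card_poly_roots_bound[OF \<open>P \<noteq> 0\<close>] by linarith
  qed
  have "K = {x \<in> K. T (c * x) = 0} \<union> {x \<in> K. T (c * x) = 1}"
    using T_cases \<open>c \<in> K\<close> by auto
  moreover have "{x \<in> K. T (c * x) = 0} \<inter> {x \<in> K. T (c * x) = 1} = {}"
    by auto
  ultimately have "card K = card {x \<in> K. T (c * x) = 0} + card {x \<in> K. T (c * x) = 1}"
    by (metis (no_types, lifting) card_Un_disjoint finite)
  then show ?thesis
    using le[of 0] le[of 1] card_K_eq_double assms(3) by auto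
qed

text \<open>By counting: z^2 + z is at most two-to-one, so its image has at least |K|/2 elements,
  and it lies in the kernel of \<open>T\<close>, which has exactly that many.\<close>

lemma artin_schreier:
  assumes "a \<in> K" "T a = 0"
  obtains z where "z \<in> K" "z\<^sup>2 + z = a"
proof -
  define g where "g = (\<lambda>z::'a. z\<^sup>2 + z)"
  have "card K = (\<Sum>b\<in>g ` K. card {z \<in> K. g z = b})"
    using sum.image_gen[of K "\<lambda>_. 1 :: nat" g] by simp
  also have "\<dots> \<le> (\<Sum>b\<in>g ` K. 2)"
  proof (rule sum_mono)
    fix b assume "b \<in> g ` K"
    then obtain y where y: "b = g y"
      by auto
    have "{z \<in> K. g z = b} \<subseteq> {y, y + 1}"
    proof
      fix z assume "z \<in> {z \<in> K. g z = b}"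
      moreover have "(z + y) * (z + (y + 1)) = g z + g y"
        by (simp add: g_def algebra_simps power2_eq_square char2_simps)
      ultimately have "(z + y) * (z + (y + 1)) = 0"
        by (simp add: y add_self)
      then show "z \<in> {y, y + 1}"
        by (simp only: mult_eq_0_iff add_eq_0_iff_eq insert_iff empty_iff simp_thms)
    qed
    then have "card {z \<in> K. g z = b} \<le> card {y, y + 1}"
      by (intro card_mono) auto
    also have "\<dots> \<le> 2"
      by (simp add: card_insert_if)
    finally show "card {z \<in> K. g z = b} \<le> 2" .
  qed
  finally have "2 ^ (k - 1) \<le> card (g ` K)"
    using card_K_eq_double by simp
  moreover have "g ` K \<subseteq> {x \<in> K. T x = 0}"
    using T_square by (auto simp: g_def T_add add_self)
  moreover have "card {x \<in> K. T x = 0} = 2 ^ (k - 1)"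
    using card_T_fibre[of 1 0] by simp
  ultimately have "g ` K = {x \<in> K. T x = 0}"
    by (intro card_seteq) auto
  then have "a \<in> g ` K"
    using assms by simp
  then show ?thesis
    using that by (auto simp: g_def)
qed

text \<open>
  If no such $w$ existed, then in terms of $p = 1 + 1/w$ the form $T(d/p)$ would vanish at every
  nonzero $p$ of the affine hyperplane $T(cp) = T(c) + 1$. Multiplied by $p^{|K|/2}$, it is a
  polynomial of degree $|K|/2 - 1$, too small for that many zeros. When the hyperplane
  contains $0$, one zero is missing; the polynomial is then compared with $T(cp)/p$, which has the
  same zeros but no term of exponent $|K|/2 - 2$.
\<close>
lemma trace_pair_exists:
  assumes "k \<ge> 3" and c: "c \<in> K" "c \<noteq> 0" and d: "d \<in> K" "d \<noteq> 0" "T d = 0"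
  obtains w where "w \<in> K" "w \<noteq> 0" "w \<noteq> 1" "T (c / w) = 1" "T (d / (w + 1)) = 1"
proof (rule ccontr)
  assume "\<not> thesis"
  then have none: "\<And>w. w \<in> K \<Longrightarrow> w \<noteq> 0 \<Longrightarrow> w \<noteq> 1 \<Longrightarrow> T (c / w) = 1 \<Longrightarrow> T (d / (w + 1)) \<noteq> 1"
    using that by blast
  \<comment> \<open>With p = 1 + 1/w one has c/w = cp + c, so T(c/w) = 1 becomes T(cp) = e. This
    rules out p = 1.\<close>
  define e where "e = T c + 1"
  have vanish: "T (d / p) = 0" if p: "p \<in> K" "p \<noteq> 0" "T (c * p) = e" for p
  proof -
    have "p \<noteq> 1"
      using p(3) by (auto simp: e_def)
    then have p1: "p + 1 \<noteq> 0"
      by (simp add: add_eq_0_iff_eq)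
    define w where "w = 1 / (p + 1)"
    have w1: "w + 1 = p / (p + 1)"
      using p1 by (simp add: w_def field_simps char2_simps)
    have "w \<in> K" "w \<noteq> 0"
      using p(1) p1 by (auto simp: w_def)
    moreover have "w \<noteq> 1"
      using w1 p(2) p1 add_self[of 1] by auto
    moreover have "c / w = c * p + c"
      by (simp add: w_def distrib_left)
    then have "T (c / w) = 1"
      using p(3) by (simp add: T_add e_def add.commute[of "T c"] add.assoc add_self)
    ultimately have "T (d / (w + 1)) \<noteq> 1"
      by (rule none)
    moreover have "d / (w + 1) = d + d / p"
      unfolding w1 using p(2) p1 by (simp add: field_simps)
    ultimately have "T (d / p) \<noteq> 1"
      using d(3) by (simp add: T_add)
    then show ?thesis
      using T_cases[of "d / p"] d(1) p(1) by auto
  qed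
  define h :: nat where "h = 2 ^ (k - 1)"
  have h_le: "2 ^ i \<le> h" if "i < k" for i
    unfolding h_def using that by (intro power_increasing) auto
  have "h = 2 * 2 ^ (k - 2)"
    unfolding h_def using \<open>k \<ge> 3\<close> by (simp flip: power_Suc add: Suc_diff_le numeral_2_eq_2)
  then have "even h"
    by simp
  have "h \<ge> 4"
    using h_le[of 2] \<open>k \<ge> 3\<close> by simp
  \<comment> \<open>This is p^h T(d/p), a polynomial since every 2^i with i < k is at most
    \<open>h\<close>.\<close>
  define P where "P = (\<Sum>i<k. monom (d ^ (2 ^ i)) (h - 2 ^ i))"
  have poly_P: "poly P p = p ^ h * T (d / p)" if "p \<noteq> 0" for p
    unfolding P_def T_def poly_sum sum_distrib_left
    using that h_le by (intro sum.cong) (auto simp: poly_monom power_diff power_divide)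
  have coeff_P: "coeff P n = (\<Sum>i<k. if i = j then d ^ (2 ^ i) else 0)"
    if "n + 2 ^ j = h" for n j
    unfolding P_def coeff_sum
  proof (rule sum.cong)
    fix i assume "i \<in> {..<k}"
    then have "2 ^ i \<le> h"
      using h_le by simp
    then have "h - 2 ^ i = n \<longleftrightarrow> (2::nat) ^ i = 2 ^ j"
      using that by linarith
    then show "coeff (monom (d ^ (2 ^ i)) (h - 2 ^ i)) n = (if i = j then d ^ (2 ^ i) else 0)"
      by simp
  qed simp
  have coeff_P1: "coeff P (h - 1) = d"
    using coeff_P[of "h - 1" 0] \<open>h \<ge> 4\<close> \<open>k \<ge> 3\<close> by simp
  have coeff_P2: "coeff P (h - 2) = d\<^sup>2"
    using coeff_P[of "h - 2" 1] \<open>h \<ge> 4\<close> \<open>k \<ge> 3\<close> by simp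
  have degree_P: "degree P \<le> h - 1"
    unfolding P_def by (intro degree_sum_le order.trans[OF degree_monom_le]) (auto intro: diff_le_mono2)
  have few_roots: "R = 0" if "degree R \<le> h - 1" "{p \<in> K. T (c * p) = e} \<subseteq> {p. poly R p = 0}" for R
  proof (rule ccontr)
    assume "R \<noteq> 0"
    have "e \<in> {0, 1}"
      using T_cases[OF c(1)] by (auto simp: e_def add_self)
    then have "h = card {p \<in> K. T (c * p) = e}"
      using card_T_fibre[OF c] by (simp add: h_def)
    also have "\<dots> \<le> card {p. poly R p = 0}"
      using that(2) by (intro card_mono) auto
    also have "\<dots> \<le> h - 1"
      using card_poly_roots_bound[OF \<open>R \<noteq> 0\<close>] that(1) by linarith
    finally show False
      using \<open>h \<ge> 4\<close> by simp
  qed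
  show False
  proof (cases "e = 0")
    case False
    have "poly P p = 0" if p: "p \<in> K" "T (c * p) = e" for p
    proof -
      have "p \<noteq> 0"
        using p(2) False by auto
      then show ?thesis
        using vanish[of p] p by (simp add: poly_P)
    qed
    then have "P = 0"
      using degree_P by (intro few_roots) auto
    then show False
      using coeff_P1 d(2) by simp
  next
    case True
    \<comment> \<open>The comparison is multiplied through by p, so that both terms also vanish at p
      = 0. The weights make the coefficients at exponent \<open>h\<close> cancel.\<close>
    define Q where "Q = smult (c ^ h) (pCons 0 P) - smult d (trace_poly c)"
    have "poly Q p = 0" if p: "p \<in> K" "T (c * p) = e" for p
      using vanish[of p] p True by (cases "p = 0") (simp_all add: Q_def poly_P poly_trace_poly)
    moreover have "degree Q \<le> h - 1"
    proof (rule degree_le, safe)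
      fix n assume "h - 1 < n"
      then consider "n = h" | "n > h"
        by linarith
      then show "coeff Q n = 0"
      proof cases
        case 1
        have "coeff (trace_poly c) h = c ^ h"
          unfolding h_def using k_pos by (intro coeff_trace_poly_power) auto
        moreover have "coeff (pCons 0 (smult (c ^ h) P)) h = c ^ h * d"
          using coeff_P1 \<open>h \<ge> 4\<close> by (cases h) simp_all
        ultimately show ?thesis
          by (simp add: Q_def 1 del: pCons_0_0)
      next
        case 2
        then have "coeff (trace_poly c) n = 0"
          using degree_trace_poly[of c] by (intro coeff_eq_0) (simp add: h_def)
        moreover have "coeff P (n - 1) = 0"
          using 2 degree_P \<open>h \<ge> 4\<close> by (intro coeff_eq_0) simp
        ultimately show ?thesis
          using 2 by (cases n) (simp_all add: Q_def)
      qed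
    qed
    ultimately have "Q = 0"
      by (intro few_roots) auto
    moreover have "coeff Q (h - 1) \<noteq> 0"
    proof -
      \<comment> \<open>\<open>h - 1\<close> is odd and at least 3, so only \<open>P\<close>
        contributes to this coefficient.\<close>
      have "(2::nat) ^ i \<noteq> h - 1" for i
      proof
        assume pow: "(2::nat) ^ i = h - 1"
        then have "i \<noteq> 0"
          using \<open>h \<ge> 4\<close> by (intro notI) simp
        then have "even ((2::nat) ^ i)"
          by simp
        then show False
          using pow \<open>even h\<close> \<open>h \<ge> 4\<close> by simp
      qed
      then have "coeff (trace_poly c) (h - 1) = 0"
        by (simp add: coeff_trace_poly)
      moreover have "coeff (pCons 0 (smult (c ^ h) P)) (h - 1) = c ^ h * d\<^sup>2"
      proof -
        have "h - 1 = Suc (h - 2)"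
          using \<open>h \<ge> 4\<close> by simp
        then show ?thesis
          using coeff_P2 by simp
      qed
      ultimately show ?thesis
        using c(2) d(2) by (simp add: Q_def)
    qed
    ultimately show False
      by simp
  qed
qed

end

subsection \<open>Quadratic extensions\<close>

text \<open>With q = 2^k, the map taking x to \<open>x ^ (2 ^ k)\<close> is the conjugation of the
  ambient field over \<open>K\<close>.\<close>

locale char2_quadratic_extension = char2_subfield K k
  for K :: "'a::finite_field set" and k :: nat +
  assumes card_UNIV: "CARD('a) = 2 ^ (2 * k)"
begin

lemma conj_conj: "(x ^ (2 ^ k)) ^ (2 ^ k) = (x :: 'a)"
  using finite_field_power_card_eq_same[of x]
  by (simp add: card_UNIV mult_2 power_add power_mult)

lemma trace_mem: "x + x ^ (2 ^ k) \<in> K"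
  unfolding mem_iff by (simp add: frobenius_add conj_conj add.commute)

lemma norm_mem: "x * x ^ (2 ^ k) \<in> K"
  unfolding mem_iff by (simp add: power_mult_distrib conj_conj mult.commute)

text \<open>The trace of \<open>a\<close> from the large field is T(a) + T(a) = 0, so a root exists
  there; T(a) = 1 makes conjugation swap the roots y and y + 1. Thus y has relative trace 1 and norm
  \<open>a\<close>.\<close>

lemma artin_schreier_root:
  assumes "a \<in> K" "T a = 1"
  obtains y where "y\<^sup>2 + y = a" "y ^ (2 ^ k) = y + 1"
proof -
  interpret big: char2_subfield "UNIV :: 'a set" "2 * k"
    by unfold_locales (use char2 is_subfield_UNIV card_UNIV in auto)
  have split: "(\<Sum>i<n + l. g i) = (\<Sum>i<n. g i) + (\<Sum>i<l. g (n + i))" for n l and g :: "nat \<Rightarrow> 'a"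
    by (induction l) (simp_all add: add.assoc)
  have "big.T a = (\<Sum>i<k + k. a ^ (2 ^ i))"
    unfolding big.T_def by (simp only: mult_2)
  also have "\<dots> = T a + (\<Sum>i<k. (a ^ (2 ^ k)) ^ (2 ^ i))"
    unfolding T_def split by (simp add: power_add power_mult)
  also have "\<dots> = 0"
    using power_card_eq[OF assms(1)] by (simp add: T_def add_self)
  finally obtain y where y: "y\<^sup>2 + y = a"
    using big.artin_schreier[of a] by auto
  then have "y ^ (2 ^ k) + y = 1"
    using T_square_add[of y] assms(2) by (simp flip: T_add)
  then have "y ^ (2 ^ k) = y + 1"
    by (metis add.commute add_add_self)
  with y show ?thesis
    by (rule that)
qed

section \<open>The trace term of f in terms of relative trace and norm\<close>

definition G :: "'a \<Rightarrow> 'a" where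
  "G x = rel_trace (2 ^ k) (x + x ^ 3 + x ^ (2 ^ k + 2) + x ^ (2 * 2 ^ k - 1))"

lemma G_0 [simp]: "G 0 = 0"
proof -
  \<comment> \<open>Positivity of 2q - 1 matters because 0^0 = 1.\<close>
  have "(2::nat) ^ k > 0"
    by simp
  then have "2 * (2::nat) ^ k - 1 > 0"
    by linarith
  then show ?thesis
    by (simp add: G_def rel_trace_def zero_power)
qed

text \<open>With z the conjugate of x, x^(2q-1) is z^2/x. The eight terms group into x^3 + x^2 z + x
  z^2 + z^3, which is (x+z)^3 in characteristic 2, and the same cubic divided by xz.\<close>

lemma G_eq:
  assumes "x \<noteq> 0"
  shows "G x = (x + x ^ (2 ^ k)) ^ 3 * (1 + 1 / (x * x ^ (2 ^ k)))"
proof -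
  define z where "z = x ^ (2 ^ k)"
  have z: "z ^ (2 ^ k) = x" "z \<noteq> 0"
    using assms by (simp_all add: z_def conj_conj)
  have conj_power: "(x ^ n) ^ (2 ^ k) = z ^ n" for n
    by (simp add: z_def mult.commute flip: power_mult)
  have z_conj_power: "(z ^ n) ^ (2 ^ k) = x ^ n" for n
    by (metis mult.commute power_mult z(1))
  have pow1: "x ^ (2 ^ k + 2) = z * x\<^sup>2"
    by (simp add: z_def power_add power2_eq_square)
  have "x * x ^ (2 * 2 ^ k - 1) = x ^ Suc (2 * 2 ^ k - 1)"
    by (rule power_Suc[symmetric])
  also have "Suc (2 * 2 ^ k - 1) = 2 ^ k * 2"
    by simp
  also have "x ^ (2 ^ k * 2) = z\<^sup>2"
    by (simp only: z_def power_mult)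
  finally have pow2: "x ^ (2 * 2 ^ k - 1) = z\<^sup>2 / x"
    using assms by (metis nonzero_eq_divide_eq mult.commute)
  have "G x = (x + x ^ 3 + z * x\<^sup>2 + z\<^sup>2 / x) + (z + z ^ 3 + x * z\<^sup>2 + x\<^sup>2 / z)"
    unfolding G_def rel_trace_def pow1 pow2 frobenius_add power_mult_distrib power_divide conj_power
    by (simp add: z(1) z_conj_power flip: z_def)
  also have "\<dots> = (x ^ 3 + z * x\<^sup>2 + x * z\<^sup>2 + z ^ 3) + (x ^ 3 + z * x\<^sup>2 + x * z\<^sup>2 + z ^ 3) / (x * z)"
    using assms z(2) by (simp add: add_divide_distrib power2_eq_square power3_eq_cube add_ac)
  also have "\<dots> = (x ^ 3 + z * x\<^sup>2 + x * z\<^sup>2 + z ^ 3) * (1 + 1 / (x * z))"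
    by (simp add: distrib_left)
  also have "x ^ 3 + z * x\<^sup>2 + x * z\<^sup>2 + z ^ 3 = (x + z) ^ 3"
    by (simp add: algebra_simps power2_eq_square power3_eq_cube char2_simps)
  finally show ?thesis
    by (simp add: z_def)
qed

lemma G_mem: "G x \<in> K"
  by (cases "x = 0") (auto simp: G_eq intro!: trace_mem norm_mem)

section \<open>Shifts by elements of K, and injectivity for \<gamma> = 1\<close>

lemma norm_shift:
  assumes "c \<in> K"
  shows "(x + c) * (x + c) ^ (2 ^ k) = x * x ^ (2 ^ k) + c * (x + x ^ (2 ^ k)) + c\<^sup>2"
  unfolding frobenius_add power_card_eq[OF assms]
  by (simp add: algebra_simps power2_eq_square)

lemma trace_shift:
  assumes "c \<in> K"
  shows "(x + c) + (x + c) ^ (2 ^ k) = x + x ^ (2 ^ k)"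
  using power_card_eq[OF assms] by (simp add: frobenius_add add_ac char2_simps)

text \<open>\<open>e\<close> and \<open>M\<close> are u and v of the overview, and
  \<open>e + M + 1\<close> is w. With P = eM and S = e + M the hypothesis reads PS = P + 1, whence P
  S^2 = P + 1 + S = (e+1)^2 + (e+1)S; division by S^2 gives the witness (e+1)/S.\<close>

lemma artin_schreier_witness:
  assumes "e \<in> K" "M \<in> K" "e \<noteq> 1" "e * M * (e + M + 1) = 1"
  obtains l where "l \<in> K" "l\<^sup>2 + l = e * M"
proof
  define S where "S = e + M"
  have "S \<noteq> 0"
  proof
    assume "S = 0"
    then have "M = e"
      by (simp add: S_def add_eq_0_iff_eq)
    then have "e\<^sup>2 = 1"
      using assms(4) by (simp add: power2_eq_square char2_simps)
    then have "(e + 1)\<^sup>2 = 0"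
      by (simp add: square_add add_self)
    then show False
      using assms(3) by (simp add: add_eq_0_iff_eq)
  qed
  define l where "l = (e + 1) / S"
  show "l \<in> K"
    using assms by (auto simp: l_def S_def)
  have PS: "e * M * S = e * M + 1"
  proof -
    have "e * M * S + e * M = 1"
      using assms(4) by (simp add: S_def algebra_simps)
    then show ?thesis
      by (metis add.commute add_add_self)
  qed
  have "e * M * S\<^sup>2 = (e * M + 1) * S"
    using PS by (simp add: power2_eq_square flip: mult.assoc)
  also have "\<dots> = e * M + 1 + S"
    using PS by (simp add: distrib_right)
  also have "\<dots> = (e + 1)\<^sup>2 + (e + 1) * S"
    by (simp add: S_def algebra_simps power2_eq_square char2_simps)
  also have "\<dots> = (l\<^sup>2 + l) * S\<^sup>2"
  proof -
    have lS: "e + 1 = l * S"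
      using \<open>S \<noteq> 0\<close> by (simp add: l_def)
    show ?thesis
      unfolding lS by (simp add: algebra_simps power2_eq_square)
  qed
  finally show "l\<^sup>2 + l = e * M"
    using \<open>S \<noteq> 0\<close> by simp
qed

lemma inj_one: "inj (\<lambda>x. x + G x)"
proof (rule injI, rule ccontr)
  fix x y assume eq: "x + G x = y + G y" and "x \<noteq> y"
  \<comment> \<open>The two points differ by \<open>c\<close>, which lies in \<open>K\<close>; hence
    they share the trace \<open>t\<close>, and only their norms can differ.\<close>
  define c where "c = G x + G y"
  have y: "y = x + c"
    using eq unfolding c_def by (metis add.assoc add.commute add_add_self)
  have "c \<in> K"
    by (simp add: c_def G_mem)
  have "c \<noteq> 0"
    using y \<open>x \<noteq> y\<close> by auto
  define t where "t = x + x ^ (2 ^ k)"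
  have ty: "y + y ^ (2 ^ k) = t"
    unfolding y t_def by (rule trace_shift) fact
  have "t \<noteq> 0"
  proof
    assume "t = 0"
    then have "G x = 0" "G y = 0"
      using G_eq[of x] G_eq[of y] ty by (cases "x = 0"; cases "y = 0"; simp add: t_def)+
    then show False
      using \<open>c \<noteq> 0\<close> by (simp add: c_def)
  qed
  then have nz: "x \<noteq> 0" "y \<noteq> 0"
    using ty by (auto simp: t_def zero_power)
  have "t \<in> K"
    unfolding t_def by (rule trace_mem)
  define n where "n = x * x ^ (2 ^ k)"
  define n' where "n' = y * y ^ (2 ^ k)"
  have n: "n \<noteq> 0" "n' \<noteq> 0" "n \<in> K"
    using nz by (auto simp: n_def n'_def intro: norm_mem)
  have n': "n' = n + c * t + c\<^sup>2"
    unfolding n'_def n_def y t_def by (rule norm_shift) fact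
  have "c = t ^ 3 * (1 + 1 / n) + t ^ 3 * (1 + 1 / n')"
    using G_eq[OF nz(1)] G_eq[OF nz(2)] unfolding ty c_def by (simp add: t_def n_def n'_def)
  also have "\<dots> = t ^ 3 * (1 / n + 1 / n')"
    by (simp add: algebra_simps char2_simps)
  also have "1 / n + 1 / n' = (n + n') / (n * n')"
    using n by (simp add: field_simps)
  also have "n + n' = c * (t + c)"
    by (simp add: n' algebra_simps power2_eq_square char2_simps)
  finally have "c * (n * n') = c * (t ^ 3 * (t + c))"
    using n by (simp add: nonzero_eq_divide_eq mult_ac)
  then have nn': "n * n' = t ^ 3 * (t + c)"
    using \<open>c \<noteq> 0\<close> by simp
  \<comment> \<open>After scaling by t the norms are uv and uw with u = 1 + c/t, so the relation for
    \<open>n * n'\<close> becomes uvw = 1.\<close>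
  define e where "e = (t + c) / t"
  define M where "M = n / t\<^sup>2 / e"
  have "t + c \<noteq> 0"
    using nn' n by auto
  then have "e \<noteq> 0"
    using \<open>t \<noteq> 0\<close> by (simp add: e_def)
  then have eM: "e * M = n / t\<^sup>2"
    by (simp add: M_def)
  have "e * (e * M * (e + M + 1)) = e * M * (e\<^sup>2 + e * M + e)"
    by (simp add: algebra_simps power2_eq_square)
  also have "e\<^sup>2 + e * M + e = n' / t\<^sup>2"
  proof -
    have "e = 1 + c / t"
      using \<open>t \<noteq> 0\<close> by (simp add: e_def add_divide_distrib)
    then have "e\<^sup>2 + e = c / t + c\<^sup>2 / t\<^sup>2"
      by (simp add: square_add power_divide add_ac char2_simps)
    moreover have "n' / t\<^sup>2 = e * M + (c / t + c\<^sup>2 / t\<^sup>2)"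
      using \<open>t \<noteq> 0\<close> by (simp add: eM n' add_divide_distrib power2_eq_square)
    ultimately show ?thesis
      by (simp add: add_ac)
  qed
  also have "e * M * (n' / t\<^sup>2) = e"
    unfolding eM using \<open>t \<noteq> 0\<close> nn'
    by (simp add: e_def power2_eq_square power3_eq_cube)
  finally have "e * M * (e + M + 1) = 1"
    using \<open>e \<noteq> 0\<close> by simp
  moreover have "e \<in> K" "M \<in> K"
    using \<open>t \<in> K\<close> \<open>c \<in> K\<close> n(3) by (auto simp: e_def M_def)
  moreover have "e \<noteq> 1"
    using \<open>c \<noteq> 0\<close> \<open>t \<noteq> 0\<close> by (simp add: e_def add_divide_distrib)
  ultimately obtain l where l: "l \<in> K" "l\<^sup>2 + l = e * M"
    using artin_schreier_witness by metis
  \<comment> \<open>\<open>r\<close> and \<open>l\<close> solve the same Artin-Schreier equation, so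
    they differ by 0 or 1. This puts x in \<open>K\<close>, where the relative trace
    vanishes.\<close>
  define r where "r = x / t"
  have "x\<^sup>2 + x * t = n"
    by (simp add: t_def n_def algebra_simps power2_eq_square char2_simps)
  then have "r\<^sup>2 + r = n / t\<^sup>2"
    using \<open>t \<noteq> 0\<close> by (auto simp: r_def power_divide add_divide_distrib power2_eq_square)
  then have "r\<^sup>2 + r = l\<^sup>2 + l"
    using l(2) eM by simp
  moreover have "(r + l) * (r + (l + 1)) = (r\<^sup>2 + r) + (l\<^sup>2 + l)"
    by (simp add: algebra_simps power2_eq_square char2_simps)
  ultimately have "r = l \<or> r = l + 1"
    by (simp only: add_self mult_eq_0_iff add_eq_0_iff_eq)
  then have "r \<in> K"
    using l(1) by auto
  then have "x \<in> K"
    using \<open>t \<in> K\<close> \<open>t \<noteq> 0\<close> mult_mem[of r t] by (simp add: r_def)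
  then have "t = 0"
    by (simp add: t_def power_card_eq add_self)
  then show False
    using \<open>t \<noteq> 0\<close> by simp
qed

section \<open>Collisions for the other values of \<gamma>\<close>

text \<open>With w = u + v + 1, the colliding points have trace 1 and norms uv and uw. Multiplying
  \<open>G\<close> by uvw turns the inverse norms into w and v, whose sum u + 1 is exactly the shift
  between the points.\<close>

lemma not_inj_if_factorization:
  assumes "u \<in> K" "v \<in> K" "u \<noteq> 1" "u * v * (u + v + 1) \<noteq> 0" "T (u * v) = 1"
  shows "\<not> inj (\<lambda>x. x + u * v * (u + v + 1) * G x)"
proof
  assume inj: "inj (\<lambda>x. x + u * v * (u + v + 1) * G x)"
  define w where "w = u + v + 1"
  have nz: "u \<noteq> 0" "v \<noteq> 0" "w \<noteq> 0"
    using assms(4) by (auto simp: w_def)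
  obtain y where y: "y\<^sup>2 + y = u * v" "y ^ (2 ^ k) = y + 1"
    using artin_schreier_root[of "u * v"] assms by auto
  define z where "z = y + (u + 1)"
  have u1: "u + 1 \<in> K"
    using assms(1) by simp
  have ny: "y * y ^ (2 ^ k) = u * v"
    using y by (simp add: algebra_simps power2_eq_square)
  have ty: "y + y ^ (2 ^ k) = 1"
    using y by (simp add: char2_simps)
  have "z * z ^ (2 ^ k) = u * v + (u + 1) + (u + 1)\<^sup>2"
    unfolding z_def norm_shift[OF u1] ny ty by simp
  also have "\<dots> = u * w"
    by (simp add: w_def algebra_simps power2_eq_square char2_simps)
  finally have nz': "z * z ^ (2 ^ k) = u * w" .
  have tz: "z + z ^ (2 ^ k) = 1"
    unfolding z_def trace_shift[OF u1] by (rule ty)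
  have "y \<noteq> 0" "z \<noteq> 0"
    using ny nz' nz by auto
  then have "G y = 1 + 1 / (u * v)" "G z = 1 + 1 / (u * w)"
    by (simp_all add: G_eq ny ty nz' tz)
  then have "u * v * w * G y = u * v * w + w" "u * v * w * G z = u * v * w + v"
    using nz by (simp_all add: distrib_left)
  moreover have "y + (u * v * w + w) = z + (u * v * w + v)"
    by (simp add: z_def w_def add_ac char2_simps)
  ultimately have "y = z"
    using injD[OF inj, of y z] by (simp add: w_def)
  then show False
    using assms(3) by (simp add: z_def add_eq_0_iff_eq)
qed

text \<open>
  A factorization $\gamma = uvw$ with $u + v + w = 1$ exists for a given $w$ as soon as $u, v$ are
  the two roots in $K$ of $X^2 + (w+1)X + \gamma/w$. The partial fraction expansion
  $1/(w(w+1)^2) = 1/w + 1/(w+1) + 1/(w+1)^2$ reduces this to two trace conditions on $w$.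
\<close>
lemma not_inj:
  assumes "k \<ge> 3" "\<gamma> \<in> K" "\<gamma> \<noteq> 0" "\<gamma> \<noteq> 1"
  shows "\<not> inj (\<lambda>x. x + \<gamma> * G x)"
proof -
  \<comment> \<open>The square root of \<gamma> in \<open>K\<close>, by inverting Frobenius.\<close>
  define s where "s = \<gamma> ^ (2 ^ (k - 1))"
  have s: "s\<^sup>2 = \<gamma>" "s \<in> K"
    using power_card_eq[OF assms(2)] k_pos assms(2)
    by (simp_all add: s_def flip: power_mult power_Suc2)
  define d where "d = s + \<gamma>"
  have "d \<in> K"
    using s assms by (simp add: d_def)
  moreover have "d \<noteq> 0"
  proof
    assume "d = 0"
    then have "s * s = s"
      using s(1) by (simp add: d_def add_eq_0_iff_eq power2_eq_square)
    then show False
      using s(1) assms(3,4) by auto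
  qed
  moreover have "T d = 0"
    using T_square[OF s(2)] s(1) by (simp add: d_def T_add add_self)
  ultimately obtain w where w: "w \<in> K" "w \<noteq> 0" "w \<noteq> 1" "T (\<gamma> / w) = 1" "T (d / (w + 1)) = 1"
    using trace_pair_exists[OF \<open>k \<ge> 3\<close> assms(2,3)] by metis
  have w1: "w + 1 \<noteq> 0"
    using w(3) by (simp add: add_eq_0_iff_eq)
  have inv_sum: "1 / w + 1 / (w + 1) + 1 / (w + 1)\<^sup>2 = 1 / (w * (w + 1)\<^sup>2)"
  proof -
    have "1 / w = (w + 1)\<^sup>2 / (w * (w + 1)\<^sup>2)"
      "1 / (w + 1) = w * (w + 1) / (w * (w + 1)\<^sup>2)"
      "1 / (w + 1)\<^sup>2 = w / (w * (w + 1)\<^sup>2)"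
      using w1 w(2) by (simp_all add: power2_eq_square)
    then have "1 / w + 1 / (w + 1) + 1 / (w + 1)\<^sup>2
        = ((w + 1)\<^sup>2 + w * (w + 1) + w) / (w * (w + 1)\<^sup>2)"
      by (simp only: add_divide_distrib)
    also have "(w + 1)\<^sup>2 + w * (w + 1) + w = 1"
      by (simp add: algebra_simps power2_eq_square char2_simps)
    finally show ?thesis .
  qed
  \<comment> \<open>Substituting X = (w+1)l turns X^2 + (w+1)X + \<gamma>/w = 0 into l^2 + l =
    a.\<close>
  define a where "a = \<gamma> / (w * (w + 1)\<^sup>2)"
  have "a = \<gamma> * (1 / w + 1 / (w + 1) + 1 / (w + 1)\<^sup>2)"
    unfolding inv_sum by (simp add: a_def)
  then have "a = \<gamma> / w + (\<gamma> / (w + 1) + \<gamma> / (w + 1)\<^sup>2)"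
    by (simp add: algebra_simps)
  \<comment> \<open>\<open>T\<close> does not distinguish an element of \<open>K\<close> from its
    square, so the last two terms merge into d/(w+1).\<close>
  moreover have "T (\<gamma> / (w + 1)\<^sup>2) = T (s / (w + 1))"
    using T_square[of "s / (w + 1)"] s w(1) by (simp add: power_divide)
  then have "T (\<gamma> / (w + 1) + \<gamma> / (w + 1)\<^sup>2) = T (d / (w + 1))"
    by (simp add: T_add d_def add_divide_distrib add.commute)
  ultimately have "T a = 0"
    using w(4,5) by (simp only: T_add add_self)
  moreover have "a \<in> K"
    using assms(2) w(1) by (simp add: a_def)
  ultimately obtain l0 where l0: "l0 \<in> K" "l0\<^sup>2 + l0 = a"
    using artin_schreier by metis
  \<comment> \<open>The root is chosen so that u = l(w+1) differs from 1; if \<open>l0\<close>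
    fails, \<open>l0 + 1\<close> gives u = w instead.\<close>
  obtain l where l: "l \<in> K" "l\<^sup>2 + l = a" "l * (w + 1) \<noteq> 1"
  proof (cases "l0 * (w + 1) = 1")
    case True
    have "(l0 + 1)\<^sup>2 + (l0 + 1) = a"
      using l0(2) by (simp add: square_add add_ac char2_simps)
    moreover have "(l0 + 1) * (w + 1) = w"
      using True by (simp add: distrib_right add_ac char2_simps)
    ultimately show ?thesis
      using that[of "l0 + 1"] l0(1) w(3) by simp
  qed (use l0 that in auto)
  define u where "u = l * (w + 1)"
  define v where "v = u + w + 1"
  have "v = (l + 1) * (w + 1)"
    by (simp add: v_def u_def algebra_simps)
  then have "u * v = (l\<^sup>2 + l) * (w + 1)\<^sup>2"
    by (simp add: u_def algebra_simps power2_eq_square)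
  then have uv: "u * v = \<gamma> / w"
    using l(2) w1 by (simp add: a_def)
  have "u + v + 1 = w"
    by (simp add: v_def add_ac char2_simps)
  then have \<gamma>: "u * v * (u + v + 1) = \<gamma>"
    using uv w(2) by simp
  have "u \<in> K" "v \<in> K"
    using l(1) w(1) by (auto simp: u_def v_def)
  then show ?thesis
    using not_inj_if_factorization[of u v] l(3) w(4) uv assms(3) unfolding \<gamma> by (simp add: u_def)
qed

end

theorem theorem3p3:
  fixes \<gamma> :: "'a::finite_field" and F\<^sub>q :: "'a set" and m q :: nat and f :: "'a poly"
  assumes "odd m" and "q = 2 ^ m"
    and "CARD('a) = q ^ 2"
    and "is_subfield F\<^sub>q" and "card F\<^sub>q = q"
    and "\<gamma> \<in> F\<^sub>q"
    and "f = X + smult \<gamma> (rel_trace q (X + X ^ 3 + X ^ (q + 2) + X ^ (2 * q - 1)))"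
  shows "permutation_polynomial f \<longleftrightarrow> \<gamma> \<in> {0, 1}"
proof -
  have card: "CARD('a) = 2 ^ (2 * m)"
    using assms(2,3) by (simp add: mult.commute flip: power_mult)
  interpret char2_quadratic_extension "F\<^sub>q" m
    by unfold_locales (use assms card CHAR_eq_2_if_CARD[OF card] in auto)
  have "poly f c = c + \<gamma> * G c" for c
    by (simp add: assms(7) poly_rel_trace G_def assms(2))
  then have perm: "permutation_polynomial f \<longleftrightarrow> inj (\<lambda>x. x + \<gamma> * G x)"
    using finite_UNIV_inj_surj[of "\<lambda>x. x + \<gamma> * G x"]
    by (auto simp: permutation_polynomial_def bij_def)
  show ?thesis
  proof
    assume "permutation_polynomial f"
    show "\<gamma> \<in> {0, 1}"
    proof (rule ccontr)
      assume \<gamma>: "\<gamma> \<notin> {0, 1}"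
      \<comment> \<open>Three distinct elements exclude q = 2, and oddness of m then gives m at
        least 3.\<close>
      have "card {0, 1, \<gamma>} \<le> card F\<^sub>q"
        using assms(6) by (intro card_mono) auto
      then have "m \<noteq> 1"
        using \<gamma> assms(2,5) by auto
      then have "m \<ge> 3"
        using \<open>odd m\<close> by (cases "m = 0"; cases "m = 2") auto
      then show False
        using not_inj[of \<gamma>] \<gamma> assms(6) perm \<open>permutation_polynomial f\<close> by auto
    qed
  next
    assume "\<gamma> \<in> {0, 1}"
    then show "permutation_polynomial f"
      unfolding perm using inj_one by (elim insertE) simp_all
  qed
qed

end
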